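(* Let $\mathsf{X} \subseteq \{n \in \mathbb{N} : n>1\}$ and let $A$ be a formula. Then $\mathsf{K} + \mathsf{4}^{\mathsf{X}} \vdash A$ if and only if $\mathsf{nK} + \Diamond_{\mathsf{4}\mathsf{X}} \vdash A$.
   Context: Formulas. Let $\mathsf{Atm}$ be a countable set of propositional variables. Formulas are in negation normal form: $A ::= p \mid \bar p \mid (A \wedge A) \mid (A \vee A) \mid \Box A \mid \Diamond A$ with $p \in \mathsf{Atm}$. The negation $\bar A$ is defined by de Morgan duality ($\bar{\bar p} = p$, $\wedge/\vee$ dual, $\Box/\Diamond$ dual), and $A\supset B := \bar A\vee B$. Axiomatic system. Modal logic $\mathsf{K}$ is the extension of classical propositional logic with the axiom schema $\mathsf{k}: \Box(A\supset B)\supset(\Box A\supset\Box B)$ and the rules modus ponens (from $A\supset B$ and $A$ infer $B$) and necessitation (from $A$ infer $\Box A$). For $n>1$, $\mathsf{4}^n$ is the axiom schema $\Diamond^n A\supset\Diamond A$, and $\mathsf{4}^{\mathsf{X}} := \{\mathsf{4}^n : n\in\mathsf{X}\}$. $\mathsf{K}+\mathsf{4}^{\mathsf{X}}$ is $\mathsf{K}$ extended with all axiom schemas in $\mathsf{4}^{\mathsf{X}}$. Nested sequents. A nested sequent is a finite (possibly empty) multiset of formulas and boxed sequents $[\Gamma]$, where $\Gamma$ is a nested sequent; comma is multiset union. A formula is regarded as the nested sequent consisting of just that formula. A context $\Gamma\{\ \}$ is a nested sequent with a hole in place of a formula (the hole is not inside a formula, but may be inside nested brackets); $\Gamma\{\Gamma_1\}$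 is the result of replacing the hole by the sequent $\Gamma_1$. Rules (premises / conclusion), for arbitrary contexts $\Gamma\{\ \}$, formulas $A,B$, variables $p$ and nested sequents $\Delta,\Delta_i$. System $\mathsf{nK}$ consists of: - $\mathsf{id}$: no premise / $\Gamma\{p,\bar p\}$; - $\vee$: $\Gamma\{A,B\}$ / $\Gamma\{A\vee B\}$; - $\wedge$: $\Gamma\{A\}$ and $\Gamma\{B\}$ / $\Gamma\{A\wedge B\}$; - $\Box$: $\Gamma\{[A]\}$ / $\Gamma\{\Box A\}$; - $\Diamond$: $\Gamma\{\Diamond A,[A,\Delta]\}$ / $\Gamma\{\Diamond A,[\Delta]\}$. For $n>1$ the rule $\Diamond_{\mathsf{4}n}$ is: $\Gamma\{\Diamond A,[\Delta_1,[\dots,[\Delta_{n-2},[\Diamond A,\Delta_{n-1}]]\dots]]\}$ / $\Gamma\{\Diamond A,[\Delta_1,[\dots,[\Delta_{n-2},[\Delta_{n-1}]]\dots]]\}$ (the new $\Diamond A$ is at nesting depth $n-1$ below the original one; e.g. for $n=2$: $\Gamma\{\Diamond A,[\Diamond A,\Delta_1]\}$ / $\Gamma\{\Diamond A,[\Delta_1]\}$). $\Diamond_{\mathsf{4}\mathsf{X}} := \{\Diamond_{\mathsf{4}n} : n\in\mathsf{X}\}$. A proof in a system is a finite tree of nested sequents built by its rules with leaves instances of $\mathsf{id}$; $\mathsf{N}\vdash\Gamma$ means there is a proof in $\mathsf{N}$ with root $\Gamma$. *)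

theory Defs
  imports "HOL-Library.Multiset" "HOL-Library.Countable"
begin

datatype 'a fml =
    Atom 'a
  | NegAtom 'a
  | And "'a fml" "'a fml"
  | Or "'a fml" "'a fml"
  | Box "'a fml"
  | Dia "'a fml"

primrec neg :: "'a fml \<Rightarrow> 'a fml" where
  "neg (Atom p) = NegAtom p"
| "neg (NegAtom p) = Atom p"
| "neg (And A B) = Or (neg A) (neg B)"
| "neg (Or A B) = And (neg A) (neg B)"
| "neg (Box A) = Dia (neg A)"
| "neg (Dia A) = Box (neg A)"

definition imp :: "'a fml \<Rightarrow> 'a fml \<Rightarrow> 'a fml" where
  "imp A B = Or (neg A) B"

lemma neg_neg [simp]: "neg (neg A) = A"
  by (induction A) simp_all

(* Boxed formulas are propositionally opaque, and a diamond formula is read as the negation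
   of its dual boxed formula. Hence the formulas true under all v are exactly the modal
   substitution instances of classical propositional tautologies. *)
primrec prop_eval :: "('a fml \<Rightarrow> bool) \<Rightarrow> 'a fml \<Rightarrow> bool" where
  "prop_eval v (Atom p) = v (Atom p)"
| "prop_eval v (NegAtom p) = (\<not> v (Atom p))"
| "prop_eval v (And A B) = (prop_eval v A \<and> prop_eval v B)"
| "prop_eval v (Or A B) = (prop_eval v A \<or> prop_eval v B)"
| "prop_eval v (Box A) = v (Box A)"
| "prop_eval v (Dia A) = (\<not> v (Box (neg A)))"

definition prop_tautology :: "'a fml \<Rightarrow> bool" where
  "prop_tautology A \<longleftrightarrow> (\<forall>v. prop_eval v A)"

inductive K_plus :: "'a fml set \<Rightarrow> 'a fml \<Rightarrow> bool" for Ax :: "'a fml set" where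
  Taut: "prop_tautology A \<Longrightarrow> K_plus Ax A"
| AxK: "K_plus Ax (imp (Box (imp A B)) (imp (Box A) (Box B)))"
| Extra: "A \<in> Ax \<Longrightarrow> K_plus Ax A"
| MP: "K_plus Ax (imp A B) \<Longrightarrow> K_plus Ax A \<Longrightarrow> K_plus Ax B"
| Nec: "K_plus Ax A \<Longrightarrow> K_plus Ax (Box A)"

definition four_axioms :: "nat set \<Rightarrow> 'a fml set" where
  "four_axioms X = {imp ((Dia ^^ n) A) (Dia A) | n A. n \<in> X}"

datatype 'a node = Fm "'a fml" | Br "'a node multiset"

type_synonym 'a nseq = "'a node multiset"

(* A context either has its hole at the top level, next to a sequent, or consists of a
   sequent together with one bracket in which the hole lies. *)
datatype 'a ctx = Hole "'a nseq" | Nest "'a nseq" "'a ctx"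

primrec fill :: "'a ctx \<Rightarrow> 'a nseq \<Rightarrow> 'a nseq" where
  "fill (Hole G) S = G + S"
| "fill (Nest G C) S = G + {#Br (fill C S)#}"

(* brackets [D1, ..., Dk] S is the sequent [D1, [D2, ... [Dk, S] ... ]]. *)
primrec brackets :: "'a nseq list \<Rightarrow> 'a nseq \<Rightarrow> 'a nseq" where
  "brackets [] S = S"
| "brackets (D # Ds) S = {#Br (D + brackets Ds S)#}"

(* Pairs (premise, conclusion). The list Ds consists of n - 1 sequents, and the new Dia A is
   added to the last of them, at depth n - 1. *)
definition dia4_rules :: "nat set \<Rightarrow> ('a nseq \<times> 'a nseq) set" where
  "dia4_rules X =
     {(fill C ({#Fm (Dia A)#} + brackets Ds {#Fm (Dia A)#}),
       fill C ({#Fm (Dia A)#} + brackets Ds {#})) | C A Ds. length Ds + 1 \<in> X}"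

inductive nK_plus :: "('a nseq \<times> 'a nseq) set \<Rightarrow> 'a nseq \<Rightarrow> bool"
  for R :: "('a nseq \<times> 'a nseq) set" where
  IdR: "nK_plus R (fill C {#Fm (Atom p), Fm (NegAtom p)#})"
| OrR: "nK_plus R (fill C {#Fm A, Fm B#}) \<Longrightarrow> nK_plus R (fill C {#Fm (Or A B)#})"
| AndR: "nK_plus R (fill C {#Fm A#}) \<Longrightarrow> nK_plus R (fill C {#Fm B#}) \<Longrightarrow>
         nK_plus R (fill C {#Fm (And A B)#})"
| BoxR: "nK_plus R (fill C {#Br {#Fm A#}#}) \<Longrightarrow> nK_plus R (fill C {#Fm (Box A)#})"
| DiaR: "nK_plus R (fill C {#Fm (Dia A), Br ({#Fm A#} + D)#}) \<Longrightarrow>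
         nK_plus R (fill C {#Fm (Dia A), Br D#})"
| ExtraR: "(S, T) \<in> R \<Longrightarrow> nK_plus R S \<Longrightarrow> nK_plus R T"

end

theory Submission
  imports Defs
begin

text \<open>Both systems are sound and complete for the Kripke frames with \<open>R\<^sup>n \<subseteq> R\<close> for all
  \<open>n \<in> X\<close>. For the axiomatic system this is the canonical model construction. For nested sequents,
  a fair proof search from an unprovable sequent produces in the limit an infinite tree whose
  formulas are falsified when a point sees its descendants at the distances
  \<open>1 + \<Sum>\<^sub>i (n\<^sub>i - 1)\<close> with \<open>n\<^sub>i \<in> X\<close>: the sum of \<open>n\<close> such distances is again one of them,
  and the propagation rules carry a diamond formula to exactly these points.\<close>

section \<open>Kripke semantics\<close>

primrec sat :: "('w \<Rightarrow> 'w \<Rightarrow> bool) \<Rightarrow> ('w \<Rightarrow> 'a \<Rightarrow> bool) \<Rightarrow> 'w \<Rightarrow> 'a fml \<Rightarrow> bool" where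
  "sat R V w (Atom p) = V w p"
| "sat R V w (NegAtom p) = (\<not> V w p)"
| "sat R V w (And A B) = (sat R V w A \<and> sat R V w B)"
| "sat R V w (Or A B) = (sat R V w A \<or> sat R V w B)"
| "sat R V w (Box A) = (\<forall>v. R w v \<longrightarrow> sat R V v A)"
| "sat R V w (Dia A) = (\<exists>v. R w v \<and> sat R V v A)"

lemma sat_neg [simp]: "sat R V w (neg A) \<longleftrightarrow> \<not> sat R V w A"
  by (induction A arbitrary: w) auto

lemma sat_imp [simp]: "sat R V w (imp A B) \<longleftrightarrow> (sat R V w A \<longrightarrow> sat R V w B)"
  by (auto simp: imp_def)

text \<open>Truth at a fixed point is itself a propositional valuation, the \<open>Dia\<close>
  clause being correct by \<open>sat_neg\<close>. This makes tautologies valid.\<close>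

lemma prop_eval_sat: "prop_eval (sat R V w) A = sat R V w A"
  by (induction A) auto

lemma sat_Dia_pow: "sat R V w ((Dia ^^ n) A) \<longleftrightarrow> (\<exists>v. (R ^^ n) w v \<and> sat R V v A)"
proof (induction n arbitrary: w)
  case 0
  show ?case by simp
next
  case (Suc n)
  show ?case
    \<comment> \<open>The outermost \<open>Dia\<close> is the first step of the path, whereas
      \<open>relpowp.simps(2)\<close> splits off the last one; hence the variants that split in
      front.\<close>
    by (auto simp: Suc simp del: relpowp.simps(2) intro: relpowp_Suc_I2 elim!: relpowp_Suc_E2)
qed

lemma K_plus_sound:
  assumes "K_plus (four_axioms X) A" and "\<And>n. n \<in> X \<Longrightarrow> R ^^ n \<le> R"
  shows "sat R V w A"
  using assms(1)
proof (induction arbitrary: w)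
  case (Taut A)
  then show ?case
    unfolding prop_tautology_def by (metis prop_eval_sat)
next
  case (Extra A)
  then obtain n B where "A = imp ((Dia ^^ n) B) (Dia B)" "n \<in> X"
    by (auto simp: four_axioms_def)
  with assms(2)[of n] show ?case
    by (auto simp: sat_Dia_pow)
qed auto

text \<open>A sequent is read as a disjunction and a bracket as a box. The point is bound by a
  lambda because it changes at a bracket, while the recursive call inside \<open>image_mset\<close>
  takes the node alone.\<close>

primrec node_sat :: "('w \<Rightarrow> 'w \<Rightarrow> bool) \<Rightarrow> ('w \<Rightarrow> 'a \<Rightarrow> bool) \<Rightarrow> 'a node \<Rightarrow> 'w \<Rightarrow> bool" where
  "node_sat R V (Fm A) = (\<lambda>w. sat R V w A)"
| "node_sat R V (Br S) = (\<lambda>w. \<forall>v. R w v \<longrightarrow> (\<exists>f \<in># image_mset (node_sat R V) S. f v))"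

definition seq_sat :: "('w \<Rightarrow> 'w \<Rightarrow> bool) \<Rightarrow> ('w \<Rightarrow> 'a \<Rightarrow> bool) \<Rightarrow> 'w \<Rightarrow> 'a nseq \<Rightarrow> bool" where
  "seq_sat R V w S \<longleftrightarrow> (\<exists>x \<in># S. node_sat R V x w)"

lemma seq_sat_simps [simp]:
  "\<not> seq_sat R V w {#}"
  "seq_sat R V w (S + T) \<longleftrightarrow> seq_sat R V w S \<or> seq_sat R V w T"
  "seq_sat R V w (add_mset x S) \<longleftrightarrow> node_sat R V x w \<or> seq_sat R V w S"
  by (auto simp: seq_sat_def)

declare node_sat.simps(2) [simp del]

lemma node_sat_Br [simp]: "node_sat R V (Br S) w \<longleftrightarrow> (\<forall>v. R w v \<longrightarrow> seq_sat R V v S)"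
  by (simp add: node_sat.simps(2) seq_sat_def)

text \<open>The hole sits under boxes and disjunctions with fixed sides, which both commute with
  conjunction. Two premises serve the conjunction rule; for the other rules they coincide.\<close>

lemma seq_sat_fill_mono:
  assumes "\<And>w. seq_sat R V w S \<Longrightarrow> seq_sat R V w S' \<Longrightarrow> seq_sat R V w T"
    and "seq_sat R V w (fill C S)" and "seq_sat R V w (fill C S')"
  shows "seq_sat R V w (fill C T)"
  using assms(2,3) by (induction C arbitrary: w) (auto intro: assms(1))

text \<open>Each bracket costs one step of \<open>R\<close>. If no point at distance
  \<open>length Ds\<close> satisfies \<open>S\<close>, then \<open>S\<close> contributes nothing in
  the innermost bracket.\<close>

lemma seq_sat_brackets:
  assumes "seq_sat R V w (brackets Ds S)"
  shows "seq_sat R V w (brackets Ds {#}) \<or> (\<exists>v. (R ^^ length Ds) w v \<and> seq_sat R V v S)"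
  using assms
proof (induction Ds arbitrary: w)
  case Nil
  then show ?case by auto
next
  case (Cons D Ds)
  show ?case
  proof (rule disjCI)
    assume none: "\<not> (\<exists>v. (R ^^ length (D # Ds)) w v \<and> seq_sat R V v S)"
    have "seq_sat R V v (D + brackets Ds {#})" if "R w v" for v
    proof -
      have "seq_sat R V v (D + brackets Ds S)"
        using Cons.prems that by simp
      moreover have "\<not> (\<exists>u. (R ^^ length Ds) v u \<and> seq_sat R V u S)"
        using none that by (metis length_Cons relpowp_Suc_I2)
      ultimately show ?thesis
        using Cons.IH[of v] by auto
    qed
    then show "seq_sat R V w (brackets (D # Ds) {#})"
      by simp
  qed
qed

lemma nK_plus_sound:
  assumes "nK_plus (dia4_rules X) S" and trans: "\<And>n. n \<in> X \<Longrightarrow> R ^^ n \<le> R"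
  shows "seq_sat R V w S"
  using assms(1)
proof (induction arbitrary: w)
  case (IdR C p)
  show ?case by (induction C arbitrary: w) auto
next
  case (OrR C A B)
  from OrR.IH[of w] OrR.IH[of w] show ?case by (rule seq_sat_fill_mono[rotated]) auto
next
  case (AndR C A B)
  from AndR.IH[of w] show ?case by (rule seq_sat_fill_mono[rotated]) auto
next
  case (BoxR C A)
  from BoxR.IH[of w] BoxR.IH[of w] show ?case by (rule seq_sat_fill_mono[rotated]) auto
next
  case (DiaR C A D)
  from DiaR.IH[of w] DiaR.IH[of w] show ?case by (rule seq_sat_fill_mono[rotated]) auto
next
  case (ExtraR S T)
  then obtain C A Ds where S: "S = fill C ({#Fm (Dia A)#} + brackets Ds {#Fm (Dia A)#})"
    and T: "T = fill C ({#Fm (Dia A)#} + brackets Ds {#})" and "length Ds + 1 \<in> X"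
    by (auto simp: dia4_rules_def)
  have "seq_sat R V w ({#Fm (Dia A)#} + brackets Ds {#})"
    if prem: "seq_sat R V w ({#Fm (Dia A)#} + brackets Ds {#Fm (Dia A)#})" for w
  proof (cases "seq_sat R V w {#Fm (Dia A)#} \<or> seq_sat R V w (brackets Ds {#})")
    case False
    \<comment> \<open>With \<open>n = length Ds + 1\<close>, the added diamond is true at a point
      \<open>v\<close> at distance \<open>n - 1\<close>, so its witness \<open>u\<close> is at
      distance \<open>n\<close> from \<open>w\<close>.\<close>
    then obtain v u where "(R ^^ length Ds) w v" "R v u" "sat R V u A"
      using prem seq_sat_brackets[of R V w Ds "{#Fm (Dia A)#}"] by auto
    moreover from this have "R w u"
      using trans[OF \<open>length Ds + 1 \<in> X\<close>] by (auto intro: relpowp_Suc_I)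
    ultimately show ?thesis by auto
  qed auto
  with ExtraR.IH[of w] show ?case
    unfolding S T by (blast intro: seq_sat_fill_mono)
qed

section \<open>The canonical model\<close>

lemma prop_eval_neg [simp]: "prop_eval v (neg A) \<longleftrightarrow> \<not> prop_eval v A"
  by (induction A) auto

lemma prop_eval_imp [simp]: "prop_eval v (imp A B) \<longleftrightarrow> (prop_eval v A \<longrightarrow> prop_eval v B)"
  by (auto simp: imp_def)

lemma prop_eval_foldr_imp [simp]:
  "prop_eval v (foldr imp L A) \<longleftrightarrow> ((\<forall>B \<in> set L. prop_eval v B) \<longrightarrow> prop_eval v A)"
  by (induction L) auto

lemma K_plus_taut1:
  assumes "K_plus Ax A" and "\<And>v. prop_eval v A \<Longrightarrow> prop_eval v B"
  shows "K_plus Ax B"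
proof (rule K_plus.MP)
  show "K_plus Ax (imp A B)"
    using assms(2) by (intro K_plus.Taut) (simp add: prop_tautology_def)
qed (rule assms(1))

lemma K_plus_taut2:
  assumes "K_plus Ax A" and "K_plus Ax B"
    and "\<And>v. prop_eval v A \<Longrightarrow> prop_eval v B \<Longrightarrow> prop_eval v C"
  shows "K_plus Ax C"
proof -
  have "K_plus Ax (imp B C)"
    using assms(1) by (rule K_plus_taut1) (use assms(3) in auto)
  then show ?thesis
    using assms(2) by (rule K_plus.MP)
qed

lemma K_plus_box_foldr_imp:
  "K_plus Ax (imp (Box (foldr imp L A)) (foldr imp (map Box L) (Box A)))"
proof (induction L)
  case Nil
  show ?case by (rule K_plus.Taut) (auto simp: prop_tautology_def)
next
  case (Cons B L)
  from Cons.IH K_plus.AxK[of Ax B "foldr imp L A"] show ?case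
    by (rule K_plus_taut2) auto
qed

text \<open>Premises enter as antecedents of a theorem, so necessitation never applies to them and
  the deduction theorem is purely propositional.\<close>

definition derives :: "'a fml set \<Rightarrow> 'a fml set \<Rightarrow> 'a fml \<Rightarrow> bool" where
  "derives Ax G A \<longleftrightarrow> (\<exists>L. set L \<subseteq> G \<and> K_plus Ax (foldr imp L A))"

lemma derives_mem: "A \<in> G \<Longrightarrow> derives Ax G A"
  unfolding derives_def
  by (rule exI[of _ "[A]"]) (auto simp: prop_tautology_def intro!: K_plus.Taut)

lemma derives_mp:
  assumes "derives Ax G (imp A B)" and "derives Ax G A"
  shows "derives Ax G B"
proof -
  obtain L M where "set L \<subseteq> G" "K_plus Ax (foldr imp L (imp A B))"
    "set M \<subseteq> G" "K_plus Ax (foldr imp M A)"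
    using assms by (auto simp: derives_def)
  moreover from this(2,4) have "K_plus Ax (foldr imp (L @ M) B)"
    by (rule K_plus_taut2) (auto simp del: foldr_append)
  ultimately show ?thesis
    unfolding derives_def by (intro exI[of _ "L @ M"]) auto
qed

lemma derives_taut:
  assumes "\<And>B. B \<in> set Bs \<Longrightarrow> derives Ax G B"
    and "\<And>v. (\<forall>B \<in> set Bs. prop_eval v B) \<Longrightarrow> prop_eval v A"
  shows "derives Ax G A"
  using assms
proof (induction Bs arbitrary: A)
  case Nil
  then have "K_plus Ax A"
    by (intro K_plus.Taut) (simp add: prop_tautology_def)
  then show ?case
    unfolding derives_def by (intro exI[of _ "[]"]) simp
next
  case (Cons B Bs)
  have "derives Ax G (imp B A)"
  proof (rule Cons.IH)
    show "derives Ax G C" if "C \<in> set Bs" for C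
      using that Cons.prems(1) by simp
    show "prop_eval v (imp B A)" if "\<forall>C \<in> set Bs. prop_eval v C" for v
      using that Cons.prems(2)[of v] by simp
  qed
  then show ?case
    by (rule derives_mp) (simp add: Cons.prems(1))
qed

lemma derives_deduction:
  assumes "derives Ax (insert B G) A"
  shows "derives Ax G (imp B A)"
proof -
  obtain L where L: "set L \<subseteq> insert B G" "K_plus Ax (foldr imp L A)"
    using assms by (auto simp: derives_def)
  \<comment> \<open>All copies of \<open>B\<close> leave the chain and a single one returns at its
    end, a propositional rearrangement of antecedents.\<close>
  from L(2) have "K_plus Ax (foldr imp (filter (\<lambda>C. C \<noteq> B) L) (imp B A))"
    by (rule K_plus_taut1) auto
  with L(1) show ?thesis
    unfolding derives_def by (intro exI[of _ "filter (\<lambda>C. C \<noteq> B) L"]) auto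
qed

text \<open>Maximal consistency in the form that Zorn's lemma yields: maximality among the sets that
  do not derive one particular formula. By \<open>mcs_neg\<close> such a set decides every
  formula.\<close>

definition mcs :: "'a fml set \<Rightarrow> 'a fml set \<Rightarrow> bool" where
  "mcs Ax G \<longleftrightarrow> (\<exists>A. \<not> derives Ax G A \<and> (\<forall>B. B \<notin> G \<longrightarrow> derives Ax (insert B G) A))"

lemma lindenbaum:
  assumes "\<not> derives Ax G A"
  obtains H where "G \<subseteq> H" and "mcs Ax H" and "A \<notin> H"
proof -
  let ?\<A> = "{H. G \<subseteq> H \<and> \<not> derives Ax H A}"
  have "\<exists>M \<in> ?\<A>. \<forall>H \<in> ?\<A>. M \<subseteq> H \<longrightarrow> H = M"
  proof (rule subset_Zorn_nonempty)
    show "?\<A> \<noteq> {}"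
      using assms by auto
  next
    fix \<C> assume \<C>: "\<C> \<noteq> {}" "subset.chain ?\<A> \<C>"
    have "\<not> derives Ax (\<Union>\<C>) A"
    proof
      assume "derives Ax (\<Union>\<C>) A"
      \<comment> \<open>A derivation has finitely many premises, so they all lie in one member of
        the chain.\<close>
      then obtain L where "set L \<subseteq> \<Union>\<C>" and L: "K_plus Ax (foldr imp L A)"
        by (auto simp: derives_def)
      with \<C> obtain H where "H \<in> \<C>" "set L \<subseteq> H"
        by (metis finite_subset_Union_chain List.finite_set)
      with L \<C>(2) show False
        unfolding derives_def subset.chain_def by blast
    qed
    moreover have "G \<subseteq> \<Union>\<C>"
      using \<C> unfolding subset.chain_def by blast
    ultimately show "\<Union>\<C> \<in> ?\<A>"
      by simp
  qed
  then obtain M where M: "G \<subseteq> M" "\<not> derives Ax M A"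
    "\<And>H. G \<subseteq> H \<Longrightarrow> \<not> derives Ax H A \<Longrightarrow> M \<subseteq> H \<Longrightarrow> H = M"
    by auto
  have "derives Ax (insert B M) A" if "B \<notin> M" for B
    using M(1) M(3)[of "insert B M"] that by blast
  with M(2) have "mcs Ax M"
    unfolding mcs_def by blast
  with M(1,2) derives_mem that show ?thesis
    by blast
qed

section \<open>Closure properties of maximal consistent sets\<close>

context
  fixes Ax G :: "'a fml set"
  assumes mcs: "mcs Ax G"
begin

lemma mcs_derives:
  assumes "derives Ax G B"
  shows "B \<in> G"
proof (rule ccontr)
  assume "B \<notin> G"
  with mcs obtain A where "\<not> derives Ax G A" "derives Ax (insert B G) A"
    by (auto simp: mcs_def)
  with derives_mp[OF derives_deduction assms] show False
    by blast
qed

lemma mcs_taut: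
  assumes "set Bs \<subseteq> G" and "\<And>v. (\<forall>B \<in> set Bs. prop_eval v B) \<Longrightarrow> prop_eval v A"
  shows "A \<in> G"
proof (rule mcs_derives, rule derives_taut)
  show "derives Ax G B" if "B \<in> set Bs" for B
    using that assms(1) by (auto intro: derives_mem)
qed (rule assms(2))

text \<open>Let \<open>A\<close> be the underivable formula. Having both \<open>B\<close> and
  \<open>neg B\<close> would yield \<open>A\<close> outright; having neither would yield
  \<open>A\<close> by case distinction, since adding either one derives it.\<close>

lemma mcs_neg: "neg B \<in> G \<longleftrightarrow> B \<notin> G"
proof -
  obtain A where A: "\<not> derives Ax G A" "\<And>C. C \<notin> G \<Longrightarrow> derives Ax (insert C G) A"
    using mcs by (auto simp: mcs_def)
  have "\<not> (B \<in> G \<and> neg B \<in> G)"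
  proof
    assume "B \<in> G \<and> neg B \<in> G"
    then have "A \<in> G"
      by (intro mcs_taut[of "[B, neg B]"]) auto
    with A(1) derives_mem show False by blast
  qed
  moreover have "B \<in> G \<or> neg B \<in> G"
  proof (rule ccontr)
    assume "\<not> ?thesis"
    then have "imp B A \<in> G" "imp (neg B) A \<in> G"
      using mcs_derives[OF derives_deduction[OF A(2)]] by blast+
    then have "A \<in> G"
      by (intro mcs_taut[of "[imp B A, imp (neg B) A]"]) auto
    with A(1) derives_mem show False by blast
  qed
  ultimately show ?thesis by blast
qed

lemma mcs_And: "And A B \<in> G \<longleftrightarrow> A \<in> G \<and> B \<in> G"
proof (intro iffI conjI)
  assume "And A B \<in> G"
  then show "A \<in> G" "B \<in> G"
    by (intro mcs_taut[of "[And A B]"]; simp)+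
next
  assume "A \<in> G \<and> B \<in> G"
  then show "And A B \<in> G"
    by (intro mcs_taut[of "[A, B]"]) auto
qed

lemma mcs_Or: "Or A B \<in> G \<longleftrightarrow> A \<in> G \<or> B \<in> G"
  using mcs_And[of "neg A" "neg B"] mcs_neg[of "Or A B"] mcs_neg[of A] mcs_neg[of B] by auto

lemma mcs_imp: "imp A B \<in> G \<longleftrightarrow> (A \<in> G \<longrightarrow> B \<in> G)"
  by (simp add: imp_def mcs_Or mcs_neg)

lemma mcs_theorem: "K_plus Ax A \<Longrightarrow> A \<in> G"
  by (rule mcs_derives) (auto simp: derives_def intro: exI[of _ "[]"])

lemma mcs_foldr_imp: "foldr imp L A \<in> G \<Longrightarrow> set L \<subseteq> G \<Longrightarrow> A \<in> G"
  by (induction L) (auto simp: mcs_imp)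

text \<open>Necessitation applies to the whole implication chain, and axiom \<open>k\<close> then
  moves the box onto each premise.\<close>

lemma mcs_Box_derives:
  assumes "derives Ax {B. Box B \<in> G} A"
  shows "Box A \<in> G"
proof -
  obtain L where L: "set L \<subseteq> {B. Box B \<in> G}" "K_plus Ax (foldr imp L A)"
    using assms unfolding derives_def by blast
  have "foldr imp (map Box L) (Box A) \<in> G"
    by (rule mcs_theorem[OF K_plus.MP[OF K_plus_box_foldr_imp K_plus.Nec[OF L(2)]]])
  then show ?thesis
    by (rule mcs_foldr_imp) (use L(1) in auto)
qed

end

text \<open>Maximal consistency is part of the relation, so the frame can live on the type of all
  sets of formulas.\<close>

definition canon :: "'a fml set \<Rightarrow> 'a fml set \<Rightarrow> 'a fml set \<Rightarrow> bool" where
  "canon Ax G H \<longleftrightarrow> mcs Ax G \<and> mcs Ax H \<and> (\<forall>B. Box B \<in> G \<longrightarrow> B \<in> H)"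

lemma canonD:
  assumes "canon Ax G H"
  shows "mcs Ax G" and "mcs Ax H" and "Box B \<in> G \<Longrightarrow> B \<in> H"
  using assms by (auto simp: canon_def)

lemma mcs_Box:
  assumes "mcs Ax G"
  shows "Box A \<in> G \<longleftrightarrow> (\<forall>H. canon Ax G H \<longrightarrow> A \<in> H)"
proof
  assume "\<forall>H. canon Ax G H \<longrightarrow> A \<in> H"
  moreover have "\<exists>H. canon Ax G H \<and> A \<notin> H" if "Box A \<notin> G"
  proof -
    \<comment> \<open>A successor omitting \<open>A\<close> is a maximal extension of the formulas
      boxed in \<open>G\<close>, which do not derive \<open>A\<close>.\<close>
    have "\<not> derives Ax {B. Box B \<in> G} A"
      using that mcs_Box_derives[OF assms] by blast
    then obtain H where "{B. Box B \<in> G} \<subseteq> H" "mcs Ax H" "A \<notin> H"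
      by (rule lindenbaum)
    then show ?thesis
      using assms by (auto simp: canon_def)
  qed
  ultimately show "Box A \<in> G" by blast
qed (auto simp: canon_def)

lemma canon_truth:
  assumes "mcs Ax G"
  shows "sat (canon Ax) (\<lambda>H p. Atom p \<in> H) G A \<longleftrightarrow> A \<in> G"
  using assms
proof (induction A arbitrary: G)
  case (NegAtom p)
  then show ?case
    using mcs_neg[of Ax G "Atom p"] by simp
next
  case (Box A)
  then show ?case
    by (auto simp: mcs_Box canonD(2))
next
  case (Dia A)
  have "Dia A \<in> G \<longleftrightarrow> Box (neg A) \<notin> G"
    using mcs_neg[OF Dia.prems, of "Dia A"] by auto
  also have "\<dots> \<longleftrightarrow> (\<exists>H. canon Ax G H \<and> neg A \<notin> H)"
    by (simp add: mcs_Box[OF Dia.prems])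
  also have "\<dots> \<longleftrightarrow> (\<exists>H. canon Ax G H \<and> A \<in> H)"
    using mcs_neg[OF canonD(2)] by metis
  finally show ?case
    using Dia.IH[OF canonD(2)] by auto
qed (auto simp: mcs_And mcs_Or)

lemma neg_Dia_pow [simp]: "neg ((Dia ^^ n) A) = (Box ^^ n) (neg A)"
  by (induction n) auto

lemma canon_pow_Box:
  assumes "(canon Ax ^^ n) G H" and "(Box ^^ n) A \<in> G"
  shows "A \<in> H"
  using assms
proof (induction n arbitrary: G)
  case (Suc n)
  then obtain F where "canon Ax G F" "(canon Ax ^^ n) F H"
    by (metis relpowp_Suc_D2)
  with Suc.IH[of F] Suc.prems(2) canonD(3) show ?case by auto
qed simp

text \<open>Contraposing the axiom at \<open>neg B\<close> turns \<open>Box B\<close> into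
  \<open>(Box ^^ n) B\<close>, which is carried along the path to give \<open>B\<close> at its
  end.\<close>

lemma canon_four:
  assumes "n \<in> X" and "n > 1"
  shows "canon (four_axioms X) ^^ n \<le> canon (four_axioms X)"
proof (intro le_funI le_boolI)
  fix G H :: "'a fml set"
  assume pow: "(canon (four_axioms X) ^^ n) G H"
  have mcs: "mcs (four_axioms X) G" "mcs (four_axioms X) H"
  proof -
    \<comment> \<open>The path has a first and a last edge, which make its endpoints maximal
      consistent; the zeroth power would relate arbitrary sets to themselves.\<close>
    obtain m where m: "n = Suc m"
      using assms(2) by (cases n) auto
    show "mcs (four_axioms X) G"
      using relpowp_Suc_D2[OF pow[unfolded m]] canonD(1) by blast
    show "mcs (four_axioms X) H"
      using relpowp_Suc_E[OF pow[unfolded m]] canonD(2) by metis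
  qed
  have "B \<in> H" if "Box B \<in> G" for B
  proof -
    have "imp ((Dia ^^ n) (neg B)) (Dia (neg B)) \<in> G"
      using assms(1) by (intro mcs_theorem[OF mcs(1)] K_plus.Extra) (auto simp: four_axioms_def)
    moreover have "Dia (neg B) \<notin> G"
      using that mcs_neg[OF mcs(1), of "Box B"] by simp
    ultimately have "(Box ^^ n) B \<in> G"
      using mcs_neg[OF mcs(1), of "(Dia ^^ n) (neg B)"] mcs_imp[OF mcs(1)] by simp
    then show ?thesis
      using pow canon_pow_Box by blast
  qed
  with mcs show "canon (four_axioms X) G H"
    by (simp add: canon_def)
qed

lemma K_plus_complete:
  fixes A :: "'a fml"
  assumes "\<And>n. n \<in> X \<Longrightarrow> n > 1"
    and valid: "\<And>(R :: 'a fml set \<Rightarrow> 'a fml set \<Rightarrow> bool) V w.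
           (\<And>n. n \<in> X \<Longrightarrow> R ^^ n \<le> R) \<Longrightarrow> sat R V w A"
  shows "K_plus (four_axioms X) A"
proof (rule ccontr)
  assume "\<not> ?thesis"
  then have "\<not> derives (four_axioms X) {} A"
    by (auto simp: derives_def)
  then obtain G where "mcs (four_axioms X) G" "A \<notin> G"
    by (rule lindenbaum)
  moreover have "sat (canon (four_axioms X)) (\<lambda>H p. Atom p \<in> H) G A"
    using assms(1) by (intro valid canon_four) auto
  ultimately show False
    using canon_truth by blast
qed

section \<open>Ordered trees\<close>

text \<open>Sequents are replaced by ordered trees so that points have stable addresses: new children
  are only appended at the end.\<close>

datatype 'a tree = Node (forms: "'a fml multiset") (subs: "'a tree list")

primrec to_seq :: "'a tree \<Rightarrow> 'a nseq" where
  "to_seq (Node F ts) = image_mset Fm F + mset (map Br (map to_seq ts))"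

fun subtree :: "'a tree \<Rightarrow> nat list \<Rightarrow> 'a tree option" where
  "subtree t [] = Some t"
| "subtree (Node F ts) (i # x) = (if i < length ts then subtree (ts ! i) x else None)"

fun replace :: "'a tree \<Rightarrow> nat list \<Rightarrow> 'a tree \<Rightarrow> 'a tree" where
  "replace t [] s = s"
| "replace (Node F ts) (i # x) s = Node F (ts[i := replace (ts ! i) x s])"

definition dom_at :: "'a tree \<Rightarrow> nat list \<Rightarrow> bool" where
  "dom_at t x \<longleftrightarrow> subtree t x \<noteq> None"

definition form_at :: "'a tree \<Rightarrow> nat list \<Rightarrow> 'a fml \<Rightarrow> bool" where
  "form_at t x A \<longleftrightarrow> (\<exists>s. subtree t x = Some s \<and> A \<in># forms s)"

lemma form_at_dom_at: "form_at t x A \<Longrightarrow> dom_at t x"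
  by (auto simp: form_at_def dom_at_def)

section \<open>Addresses under replacement\<close>

lemma subtree_append: "subtree t (x @ y) = Option.bind (subtree t x) (\<lambda>s. subtree s y)"
  by (induction t x rule: subtree.induct) auto

lemma dom_at_append: "dom_at t (x @ y) \<Longrightarrow> dom_at t x"
  by (cases "subtree t x") (auto simp: dom_at_def subtree_append)

lemma replace_self: "subtree t x = Some s \<Longrightarrow> replace t x s = t"
  by (induction t x rule: subtree.induct) (auto split: if_splits)

lemma replace_append:
  "subtree t x = Some s \<Longrightarrow> replace t (x @ y) u = replace t x (replace s y u)"
  by (induction t x rule: subtree.induct) (auto split: if_splits)

lemma subtree_replace_below:
  "subtree t x = Some s \<Longrightarrow> subtree (replace t x s') (x @ y) = subtree s' y"
  by (induction t x rule: subtree.induct) (auto split: if_splits)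

text \<open>Appending children shifts no index, so every old address survives, and formulas change
  at \<open>x\<close> only. The child list \<open>us\<close> is left open because it changes at
  \<open>x\<close> and above it.\<close>

lemma subtree_replace:
  assumes "subtree t x = Some (Node F ts)" and "subtree t y = Some u"
  shows "\<exists>us. subtree (replace t x (Node F' (ts @ new))) y
            = Some (Node (if y = x then F' else forms u) us)"
  using assms
proof (induction t x arbitrary: y rule: subtree.induct)
  case (1 t)
  then show ?case
    by (cases y; cases u) (auto simp: nth_append split: if_splits)
next
  case (2 G us i x)
  show ?case
  proof (cases y)
    case Nil
    with 2 show ?thesis by auto
  next
    case (Cons j z)
    show ?thesis
    proof (cases "i = j")
      case True
      have "i < length us" "subtree (us ! i) x = Some (Node F ts)"
        using 2(2) by (auto split: if_splits)
      moreover have "subtree (us ! i) z = Some u"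
        using 2(3) Cons True calculation by simp
      ultimately have "\<exists>vs. subtree (replace (us ! i) x (Node F' (ts @ new))) z
          = Some (Node (if z = x then F' else forms u) vs)"
        by (rule 2(1))
      with True Cons \<open>i < length us\<close> show ?thesis by simp
    next
      case False
      with 2(3) Cons show ?thesis
        by (cases u) (auto split: if_splits)
    qed
  qed
qed

section \<open>Tree replacement as filling a context\<close>

lemma mset_subs_update:
  assumes "i < length ts"
  obtains S where "\<And>s. mset (map Br (map to_seq (ts[i := s]))) = S + {#Br (to_seq s)#}"
proof
  show "mset (map Br (map to_seq (ts[i := s])))
      = (mset (map Br (map to_seq ts)) - {#Br (to_seq (ts ! i))#}) + {#Br (to_seq s)#}" for s
    using assms by (simp add: map_update mset_update)
qed

text \<open>The context is independent of \<open>s'\<close>, so premise and conclusion of a rule are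
  fillings of the same context.\<close>

lemma to_seq_replace:
  assumes "subtree t x = Some s"
  shows "\<exists>C. \<forall>s'. to_seq (replace t x s') = fill C (to_seq s')"
  using assms
proof (induction t x rule: subtree.induct)
  case (1 t)
  show ?case by (intro exI[of _ "Hole {#}"]) simp
next
  case (2 F ts i x)
  then obtain C where C: "\<And>s'. to_seq (replace (ts ! i) x s') = fill C (to_seq s')" and "i < length ts"
    by (auto split: if_splits)
  from this(2) obtain S where
    "\<And>s. mset (map Br (map to_seq (ts[i := s]))) = S + {#Br (to_seq s)#}"
    by (rule mset_subs_update) blast
  then show ?case
    by (intro exI[of _ "Nest (image_mset Fm F + S) C"]) (simp add: C del: map_map mset_map)
qed

lemma fill_absorb: "\<exists>C'. \<forall>S. fill C (G + S) = fill C' S"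
proof (induction C)
  case (Hole H)
  show ?case by (intro exI[of _ "Hole (H + G)"]) (simp add: ac_simps)
next
  case (Nest H C)
  then obtain C' where "\<forall>S. fill C (G + S) = fill C' S" ..
  then show ?case by (intro exI[of _ "Nest H C'"]) simp
qed

text \<open>Kept formulas and old children move into the context. The hole then holds just the
  principal part \<open>F0\<close>, or what a premise puts in its place.\<close>

lemma to_seq_replace_Node:
  assumes "subtree t x = Some (Node (F + F0) ts)"
  shows "\<exists>C. \<forall>F' new. to_seq (replace t x (Node (F + F') (ts @ new)))
           = fill C (image_mset Fm F' + mset (map Br (map to_seq new)))"
proof -
  obtain C where C: "\<And>s'. to_seq (replace t x s') = fill C (to_seq s')"
    using to_seq_replace[OF assms] by blast
  obtain C' where C': "\<And>S. fill C (to_seq (Node F ts) + S) = fill C' S"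
    using fill_absorb by blast
  show ?thesis
    by (intro exI[of _ C']) (simp add: C C'[symmetric] ac_simps)
qed

text \<open>Whatever lies beside the path \<open>z\<close> is collected in \<open>G\<close> at the
  root and in \<open>Ds\<close> below it. As neither depends on \<open>M\<close>, an empty and a
  singleton \<open>M\<close> give conclusion and premise of a diamond rule.\<close>

lemma to_seq_brackets:
  assumes "subtree s z = Some (Node F ts)"
  shows "\<exists>G Ds. length Ds = length z \<and> (z \<noteq> [] \<longrightarrow> image_mset Fm (forms s) \<subseteq># G) \<and>
           (\<forall>M. to_seq (replace s z (Node (F + M) ts)) = G + brackets Ds (image_mset Fm M))"
  using assms
proof (induction s z rule: subtree.induct)
  case (1 s)
  then show ?case
    by (intro exI[of _ "to_seq s"] exI[of _ "[]"]) (simp add: ac_simps)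
next
  case (2 H us i z)
  then obtain G Ds where "i < length us" and Ds: "length Ds = length z"
    "\<And>M. to_seq (replace (us ! i) z (Node (F + M) ts)) = G + brackets Ds (image_mset Fm M)"
    by (auto split: if_splits)
  from this(1) obtain S where
    "\<And>s. mset (map Br (map to_seq (us[i := s]))) = S + {#Br (to_seq s)#}"
    by (rule mset_subs_update) blast
  with Ds show ?case
    by (intro exI[of _ "image_mset Fm H + S"] exI[of _ "G # Ds"]) (simp del: map_map mset_map)
qed

lemma to_seq_replace_brackets:
  assumes "subtree t x = Some s" and "A \<in># forms s" and "subtree s z = Some (Node F ts)"
    and "z \<noteq> []"
  shows "\<exists>C Ds. length Ds = length z \<and>
    (\<forall>M. to_seq (replace t (x @ z) (Node (F + M) ts))
         = fill C ({#Fm A#} + brackets Ds (image_mset Fm M)))"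
proof -
  obtain C where C: "\<And>s'. to_seq (replace t x s') = fill C (to_seq s')"
    using to_seq_replace[OF assms(1)] by blast
  obtain G Ds where Ds: "length Ds = length z" "image_mset Fm (forms s) \<subseteq># G"
    "\<And>M. to_seq (replace s z (Node (F + M) ts)) = G + brackets Ds (image_mset Fm M)"
    using to_seq_brackets[OF assms(3)] assms(4) by blast
  have "Fm A \<in># G"
    by (rule mset_subset_eqD[OF Ds(2)]) (use assms(2) in auto)
  then obtain G' where G': "G = G' + {#Fm A#}"
    by (metis insert_DiffM2)
  obtain C' where C': "\<And>S. fill C (G' + S) = fill C' S"
    using fill_absorb by blast
  show ?thesis
    by (intro exI[of _ C'] exI[of _ Ds])
       (simp add: Ds(1,3) G' C C'[symmetric] replace_append[OF assms(1)])
qed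

section \<open>Fair proof search\<close>

definition unprovable :: "nat set \<Rightarrow> 'a tree \<Rightarrow> bool" where
  "unprovable X t \<longleftrightarrow> \<not> nK_plus (dia4_rules X) (to_seq t)"

text \<open>The formulas that no rule consumes: literals are never decomposed, and the diamond rules
  keep their principal formula.\<close>

primrec persistent :: "'a fml \<Rightarrow> bool" where
  "persistent (Atom p) = True"
| "persistent (NegAtom p) = True"
| "persistent (And A B) = False"
| "persistent (Or A B) = False"
| "persistent (Box A) = False"
| "persistent (Dia A) = True"

text \<open>Bounds the loss in one step: only the principal formula \<open>A\<close> at
  \<open>x\<close> may vanish. The limit argument uses this to tell which task removed a
  formula.\<close>

definition extends :: "nat list \<Rightarrow> 'a fml \<Rightarrow> 'a tree \<Rightarrow> 'a tree \<Rightarrow> bool" where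
  "extends x A t t' \<longleftrightarrow> (\<forall>y. dom_at t y \<longrightarrow> dom_at t' y) \<and>
     (\<forall>y B. form_at t y B \<longrightarrow> form_at t' y B \<or> y = x \<and> B = A \<and> \<not> persistent A)"

text \<open>The flag tells whether a diamond formula at \<open>x\<close> acts on the point \<open>x @ z\<close> by its ordinary
  rule or by a propagation rule.\<close>

primrec resolved :: "nat set \<Rightarrow> 'a tree \<Rightarrow> 'a tree \<Rightarrow> nat list \<Rightarrow> nat list \<Rightarrow> bool \<Rightarrow> 'a fml \<Rightarrow> bool" where
  "resolved X t t' x z b (Atom p) = True"
| "resolved X t t' x z b (NegAtom p) = True"
| "resolved X t t' x z b (And A B) = (form_at t' x A \<or> form_at t' x B)"
| "resolved X t t' x z b (Or A B) = (form_at t' x A \<and> form_at t' x B)"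
| "resolved X t t' x z b (Box A) = (\<exists>i. form_at t' (x @ [i]) A)"
| "resolved X t t' x z b (Dia A) = (dom_at t (x @ z) \<longrightarrow>
     (if b then length z = 1 \<longrightarrow> form_at t' (x @ z) A
      else z \<noteq> [] \<and> length z + 1 \<in> X \<longrightarrow> form_at t' (x @ z) (Dia A)))"

lemma extends_refl: "extends x A t t"
  by (simp add: extends_def)

lemma extends_replace:
  assumes "subtree t x = Some (Node F ts)"
    and "\<And>B. B \<in># F \<Longrightarrow> B \<in># F' \<or> B = A \<and> \<not> persistent A"
  shows "extends x A t (replace t x (Node F' (ts @ new)))"
proof -
  have *: "\<exists>us. subtree (replace t x (Node F' (ts @ new))) y
      = Some (Node (if y = x then F' else forms u) us)" if "subtree t y = Some u" for y u
    using subtree_replace[OF assms(1) that] .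
  show ?thesis
    unfolding extends_def
  proof (intro conjI allI impI)
    fix y assume "dom_at t y"
    with * show "dom_at (replace t x (Node F' (ts @ new))) y"
      unfolding dom_at_def by blast
  next
    fix y B assume "form_at t y B"
    then obtain u where u: "subtree t y = Some u" "B \<in># forms u"
      by (auto simp: form_at_def)
    have "B \<in># F' \<or> B = A \<and> \<not> persistent A" if "y = x"
      using that u assms(1) by (intro assms(2)) auto
    with *[OF u(1)] u(2)
    show "form_at (replace t x (Node F' (ts @ new))) y B \<or> y = x \<and> B = A \<and> \<not> persistent A"
      by (cases "y = x") (auto simp: form_at_def)
  qed
qed

lemma form_at_replace:
  assumes "subtree t x = Some s"
  shows "form_at (replace t x (Node F ts)) x B \<longleftrightarrow> B \<in># F"
  using subtree_replace_below[OF assms, of _ "[]"] by (auto simp: form_at_def)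

text \<open>A rule read upwards: if the conclusion is unprovable, so is one of its premises, and
  that premise resolves \<open>A\<close>.\<close>

lemma proof_search_step:
  assumes "unprovable X t"
  shows "\<exists>t'. unprovable X t' \<and> extends x A t t' \<and> (form_at t x A \<longrightarrow> resolved X t t' x z b A)"
proof (cases "form_at t x A")
  case False
  with assms extends_refl show ?thesis by blast
next
  case True
  then obtain F ts where "subtree t x = Some (Node F ts)" "A \<in># F"
    unfolding form_at_def by (metis tree.collapse)
  \<comment> \<open>One occurrence of \<open>A\<close> is set aside as principal; further copies may
    remain in \<open>F0\<close>.\<close>
  then obtain F0 where t: "subtree t x = Some (Node (F0 + {#A#}) ts)"
    by (metis insert_DiffM2)
  obtain C where C: "\<And>F' new. to_seq (replace t x (Node (F0 + F') (ts @ new)))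
           = fill C (image_mset Fm F' + mset (map Br (map to_seq new)))"
    using to_seq_replace_Node[OF t] by blast
  have t_seq: "to_seq t = fill C {#Fm A#}"
    using C[of "{#A#}" "[]"] replace_self[OF t] by simp
  have step: ?thesis
    if "unprovable X (replace t x (Node (F0 + F') (ts @ new)))" "\<not> persistent A"
      "resolved X t (replace t x (Node (F0 + F') (ts @ new))) x z b A" for F' new
    using that extends_replace[OF t, of "F0 + F'" A new] by auto
  show ?thesis
  proof (cases A)
    case (Atom p)
    with assms extends_refl show ?thesis by fastforce
  next
    case (NegAtom p)
    with assms extends_refl show ?thesis by fastforce
  next
    case (And B D)
    have "unprovable X (replace t x (Node (F0 + {#B#}) (ts @ []))) \<or>
          unprovable X (replace t x (Node (F0 + {#D#}) (ts @ [])))"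
      using assms nK_plus.AndR[of "dia4_rules X" C B D]
      unfolding unprovable_def t_seq C And by auto
    then show ?thesis
      using step[of "{#B#}" "[]"] step[of "{#D#}" "[]"] And by (auto simp: form_at_replace[OF t])
  next
    case (Or B D)
    have "unprovable X (replace t x (Node (F0 + {#B, D#}) (ts @ [])))"
      using assms nK_plus.OrR[of "dia4_rules X" C B D]
      unfolding unprovable_def t_seq C Or by auto
    then show ?thesis
      using step[of "{#B, D#}" "[]"] Or by (auto simp: form_at_replace[OF t])
  next
    case (Box B)
    have "unprovable X (replace t x (Node (F0 + {#}) (ts @ [Node {#B#} []])))"
      using assms nK_plus.BoxR[of "dia4_rules X" C B]
      unfolding unprovable_def t_seq C Box by auto
    moreover have "form_at (replace t x (Node (F0 + {#}) (ts @ [Node {#B#} []]))) (x @ [length ts]) B"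
      by (simp add: form_at_def subtree_replace_below[OF t])
    ultimately show ?thesis
      using step[of "{#}" "[Node {#B#} []]"] Box by auto
  next
    case (Dia B)
    show ?thesis
    \<comment> \<open>Without such a point below \<open>x\<close>, \<open>resolved\<close> demands
      nothing and \<open>t\<close> itself serves.\<close>
    proof (cases "dom_at t (x @ z) \<and> z \<noteq> []")
      case False
      with assms extends_refl Dia show ?thesis by fastforce
    next
      case dom: True
      let ?s = "Node (F0 + {#A#}) ts"
      obtain G us where u: "subtree ?s z = Some (Node G us)"
        using dom t by (auto simp: dom_at_def subtree_append) (metis tree.collapse)
      have tz: "subtree t (x @ z) = Some (Node G us)"
        using t u by (simp add: subtree_append)
      obtain C' Ds where Ds: "length Ds = length z"
        "\<And>M. to_seq (replace t (x @ z) (Node (G + M) us))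
              = fill C' ({#Fm A#} + brackets Ds (image_mset Fm M))"
        using to_seq_replace_brackets[OF t _ u] dom
        by (metis tree.sel(1) union_single_eq_member union_commute add_mset_add_single)
      have t_seq': "to_seq t = fill C' ({#Fm A#} + brackets Ds {#})"
        using Ds(2)[of "{#}"] replace_self[OF tz] by simp
      \<comment> \<open>The ordinary rule sends the body \<open>B\<close> to \<open>x @ z\<close>;
        propagation sends the diamond formula itself.\<close>
      define D where "D = (if b then B else A)"
      let ?t' = "replace t (x @ z) (Node (G + {#D#}) us)"
      \<comment> \<open>The replacement takes place at \<open>x @ z\<close>, but a diamond is
        persistent, so nothing is lost and \<open>x\<close> may be named instead.\<close>
      have ext: "extends x A t ?t'"
        using extends_replace[OF tz, of "G + {#D#}" A "[]"] Dia by (auto simp: extends_def)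
      show ?thesis
      proof (cases "if b then length z = 1 else length z + 1 \<in> X")
        case True
        have "nK_plus (dia4_rules X) (to_seq t)" if prov: "nK_plus (dia4_rules X) (to_seq ?t')"
        proof (cases b)
          case True
          with \<open>if b then _ else _\<close> Ds(1) obtain E where "Ds = [E]"
            by (auto simp: length_Suc_conv)
          with prov True show ?thesis
            using nK_plus.DiaR[of "dia4_rules X" C' B E]
            unfolding t_seq' Ds(2) D_def Dia by (simp add: add_mset_commute)
        next
          case False
          have "(to_seq ?t', to_seq t) \<in> dia4_rules X"
          proof -
            have "length Ds + 1 \<in> X"
              using \<open>if b then _ else _\<close> False Ds(1) by simp
            moreover have "to_seq ?t' = fill C' ({#Fm (Dia B)#} + brackets Ds {#Fm (Dia B)#})"
              using False Ds(2)[of "{#A#}"] by (simp add: D_def Dia)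
            ultimately show ?thesis
              unfolding dia4_rules_def using t_seq' Dia by blast
          qed
          then show ?thesis
            using prov by (rule nK_plus.ExtraR)
        qed
        then have "unprovable X ?t'"
          using assms by (auto simp: unprovable_def)
        moreover have "form_at ?t' (x @ z) D"
          by (simp add: form_at_replace[OF tz])
        ultimately show ?thesis
          using ext Dia by (auto simp: D_def intro!: exI[of _ ?t'])
      next
        case False
        with assms extends_refl Dia show ?thesis by (fastforce split: if_splits)
      qed
    qed
  qed
qed

section \<open>The limit of a fair search\<close>

instance fml :: (countable) countable
  by countable_datatype

text \<open>The second component of the pair code is padding: it makes every task recur at
  arbitrarily large indices.\<close>

lemma fair_schedule:
  obtains f :: "nat \<Rightarrow> 'b::countable" where "\<And>c n. \<exists>m \<ge> n. f m = c"
proof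
  fix c :: 'b and n
  show "\<exists>m \<ge> n. from_nat (fst (prod_decode m)) = c"
    by (intro exI[of _ "prod_encode (to_nat c, n)"]) (simp add: le_prod_encode_2)
qed

text \<open>Hintikka conditions for falsification: \<open>H x A\<close> demands that
  \<open>A\<close> fail at \<open>x\<close>, so a conjunction needs one failing part and a
  disjunction two. In \<open>Dia4\<close> the length of \<open>z\<close> is \<open>n - 1\<close> for
  some \<open>n\<close> in \<open>X\<close>.\<close>

locale saturated =
  fixes X :: "nat set" and D :: "nat list \<Rightarrow> bool" and H :: "nat list \<Rightarrow> 'a fml \<Rightarrow> bool"
  assumes prefix: "D (x @ y) \<Longrightarrow> D x"
    and dom: "H x A \<Longrightarrow> D x"
    and clash: "H x (Atom p) \<Longrightarrow> \<not> H x (NegAtom p)"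
    and And: "H x (And A B) \<Longrightarrow> H x A \<or> H x B"
    and Or: "H x (Or A B) \<Longrightarrow> H x A \<and> H x B"
    and Box: "H x (Box A) \<Longrightarrow> \<exists>i. H (x @ [i]) A"
    and Dia: "H x (Dia A) \<Longrightarrow> D (x @ [i]) \<Longrightarrow> H (x @ [i]) A"
    and Dia4: "H x (Dia A) \<Longrightarrow> D (x @ z) \<Longrightarrow> z \<noteq> [] \<Longrightarrow> length z + 1 \<in> X \<Longrightarrow> H (x @ z) (Dia A)"

lemma unprovable_clash:
  assumes "unprovable X t"
  shows "\<not> (form_at t x (Atom p) \<and> form_at t x (NegAtom p))"
proof
  assume "form_at t x (Atom p) \<and> form_at t x (NegAtom p)"
  then obtain F ts where t: "subtree t x = Some (Node F ts)" and "Atom p \<in># F" "NegAtom p \<in># F"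
    unfolding form_at_def by (metis option.inject tree.collapse)
  then obtain F0 where F: "F = F0 + {#Atom p, NegAtom p#}"
    by (metis add_mset_commute fml.distinct(1) insert_noteq_member multi_member_split
        union_mset_add_mset_right add.right_neutral)
  from t obtain C where "\<And>F' new. to_seq (replace t x (Node (F0 + F') (ts @ new)))
           = fill C (image_mset Fm F' + mset (map Br (map to_seq new)))"
    unfolding F using to_seq_replace_Node by blast
  from this[of "{#Atom p, NegAtom p#}" "[]"] t
  have "to_seq t = fill C {#Fm (Atom p), Fm (NegAtom p)#}"
    by (simp add: F replace_self)
  with assms show False
    by (simp add: unprovable_def nK_plus.IdR)
qed

text \<open>\<open>D\<close> and \<open>H\<close> collect what exists at some stage. A consumed
  formula stays in \<open>H\<close>, and its condition holds because it can vanish only by being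
  resolved. Two clashing literals would persist to a common stage.\<close>

lemma unprovable_saturated:
  fixes t :: "'a::countable tree"
  assumes "unprovable X t"
  obtains D H where "saturated X D H" and "\<And>x A. form_at t x A \<Longrightarrow> H x A"
proof -
  obtain task :: "nat \<Rightarrow> nat list \<times> 'a fml \<times> nat list \<times> bool"
    where task: "\<And>c n. \<exists>m \<ge> n. task m = c"
    using fair_schedule by blast
  define good where "good n t t' \<longleftrightarrow> (case task n of (x, A, z, b) \<Rightarrow>
      extends x A t t' \<and> (form_at t x A \<longrightarrow> resolved X t t' x z b A))" for n :: nat and t t'
  have "\<exists>f. \<forall>n. (unprovable X (f n) \<and> (n = 0 \<longrightarrow> f n = t)) \<and> good n (f n) (f (Suc n))"
  proof (rule dependent_nat_choice)
    show "\<exists>s. unprovable X s \<and> (0 = 0 \<longrightarrow> s = t)"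
      using assms by blast
  next
    fix s and n :: nat assume "unprovable X s \<and> (n = 0 \<longrightarrow> s = t)"
    then show "\<exists>s'. (unprovable X s' \<and> (Suc n = 0 \<longrightarrow> s' = t)) \<and> good n s s'"
      using proof_search_step[of X s] by (cases "task n") (auto simp: good_def)
  qed
  then obtain f where unprov: "\<And>n. unprovable X (f n)" and f0: "f 0 = t"
    and good: "\<And>n. good n (f n) (f (Suc n))"
    by metis
  define D where "D x \<longleftrightarrow> (\<exists>n. dom_at (f n) x)" for x
  define H where "H x A \<longleftrightarrow> (\<exists>n. form_at (f n) x A)" for x A
  have ext: "\<exists>x A z b. task n = (x, A, z, b) \<and> extends x A (f n) (f (Suc n))" for n
    using good[of n] by (auto simp: good_def split: prod.splits)
  have dom_mono: "dom_at (f m) x" if "dom_at (f n) x" "n \<le> m" for n m x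
    using that(2,1) by (induction rule: dec_induct) (use ext in \<open>auto simp: extends_def\<close>)
  have persist: "form_at (f m) x A" if "form_at (f n) x A" "n \<le> m" "persistent A" for n m x A
    using that(2,1) by (induction rule: dec_induct) (use ext that(3) in \<open>fastforce simp: extends_def\<close>)+
  \<comment> \<open>The bound \<open>k\<close> asks for a late resolution, which a persistent
    formula can await. For diamonds \<open>k\<close> will be a stage at which the target
    \<open>x @ z\<close> already exists.\<close>
  have resolve: "\<exists>m \<ge> k. resolved X (f m) (f (Suc m)) x z b A"
    if form: "form_at (f n) x A" and k: "persistent A \<or> k = n" for n k x z b A
  proof -
    define P where "P m \<longleftrightarrow> max k n \<le> m \<and> task m = (x, A, z, b)" for m
    obtain m0 where "P m0"
      using task unfolding P_def by blast
    show ?thesis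
    proof (cases "persistent A")
      case True
      with form \<open>P m0\<close> have "form_at (f m0) x A"
        unfolding P_def by (auto intro: persist[OF form])
      with good[of m0] \<open>P m0\<close> have "m0 \<ge> k" "resolved X (f m0) (f (Suc m0)) x z b A"
        unfolding P_def by (auto simp: good_def)
      then show ?thesis by blast
    next
      case False
      \<comment> \<open>Before its scheduled stage, \<open>A\<close> can disappear only through
        another task for \<open>A\<close> at \<open>x\<close>, which then resolves it.\<close>
      have "form_at (f m) x A \<or> (\<exists>j \<ge> n. resolved X (f j) (f (Suc j)) x z b A)"
        if "n \<le> m" for m
        using that
      proof (induction rule: dec_induct)
        case base
        show ?case using form by simp
      next
        case (step m)
        show ?case
        proof (cases "form_at (f m) x A \<and> \<not> form_at (f (Suc m)) x A")
          case True
          obtain y B w c where y: "task m = (y, B, w, c)" "extends y B (f m) (f (Suc m))"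
            using ext by blast
          with True have "y = x" "B = A"
            by (auto simp: extends_def)
          with good[of m] y True have "resolved X (f m) (f (Suc m)) x w c A"
            by (auto simp: good_def)
          \<comment> \<open>The task that consumed \<open>A\<close> may carry a different address
            and flag, but \<open>resolved\<close> depends on these only for diamonds.\<close>
          then have "resolved X (f m) (f (Suc m)) x z b A"
            using False by (cases A) simp_all
          with step.hyps show ?thesis by blast
        next
          case False
          with step.IH show ?thesis by blast
        qed
      qed
      from this[of m0] \<open>P m0\<close>
      have "form_at (f m0) x A \<or> (\<exists>j \<ge> n. resolved X (f j) (f (Suc j)) x z b A)"
        unfolding P_def by simp
      moreover have "k = n"
        using k False by simp
      moreover have "m0 \<ge> n" "form_at (f m0) x A \<longrightarrow> resolved X (f m0) (f (Suc m0)) x z b A"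
        using good[of m0] \<open>P m0\<close> unfolding P_def by (auto simp: good_def)
      ultimately show ?thesis by blast
    qed
  qed
  have dia: "\<exists>m. resolved X (f m) (f (Suc m)) x z b (Dia A) \<and> dom_at (f m) (x @ z)"
    if "H x (Dia A)" "D (x @ z)" for x A z b
  proof -
    obtain n k where "form_at (f n) x (Dia A)" "dom_at (f k) (x @ z)"
      using \<open>H x (Dia A)\<close> \<open>D (x @ z)\<close> unfolding H_def D_def by blast
    with resolve[of n x "Dia A" k z b] dom_mono show ?thesis
      by auto
  qed
  have "saturated X D H"
  proof
    show "D x" if "D (x @ y)" for x y
      using that dom_at_append unfolding D_def by blast
    show "D x" if "H x A" for x A
      using that form_at_dom_at unfolding D_def H_def by blast
    show "\<not> H x (NegAtom p)" if "H x (Atom p)" for x p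
    proof
      assume "H x (NegAtom p)"
      with that obtain n m where "form_at (f n) x (Atom p)" "form_at (f m) x (NegAtom p)"
        unfolding H_def by blast
      then have "form_at (f (max n m)) x (Atom p)" "form_at (f (max n m)) x (NegAtom p)"
        by (auto elim: persist)
      with unprovable_clash[OF unprov] show False by metis
    qed
    show "H x A \<or> H x B" if form: "H x (And A B)" for x A B
    proof -
      obtain n where "form_at (f n) x (And A B)"
        using form unfolding H_def by blast
      from resolve[OF this, of n] show ?thesis
        unfolding H_def by auto
    qed
    show "H x A \<and> H x B" if form: "H x (Or A B)" for x A B
    proof -
      obtain n where "form_at (f n) x (Or A B)"
        using form unfolding H_def by blast
      from resolve[OF this, of n] show ?thesis
        unfolding H_def by auto
    qed
    show "\<exists>i. H (x @ [i]) A" if form: "H x (Box A)" for x A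
    proof -
      obtain n where "form_at (f n) x (Box A)"
        using form unfolding H_def by blast
      from resolve[OF this, of n] show ?thesis
        unfolding H_def by auto
    qed
    show "H (x @ [i]) A" if "H x (Dia A)" "D (x @ [i])" for x A i
      using dia[OF that, of True] unfolding H_def by auto
    show "H (x @ z) (Dia A)"
      if "H x (Dia A)" "D (x @ z)" "z \<noteq> []" "length z + 1 \<in> X" for x A z
      using dia[OF that(1,2), of False] that(3,4) unfolding H_def by auto
  qed
  moreover have "H x A" if "form_at t x A" for x A
    using that f0 unfolding H_def by blast
  ultimately show thesis
    by (rule that)
qed

section \<open>The countermodel\<close>

definition tree_rel :: "nat set \<Rightarrow> (nat list \<Rightarrow> bool) \<Rightarrow> nat list \<Rightarrow> nat list \<Rightarrow> bool" where
  "tree_rel X D x y \<longleftrightarrow> D y \<and> (\<exists>z ns. y = x @ z \<and> set ns \<subseteq> X \<and>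
     length z = 1 + sum_list (map (\<lambda>n. n - 1) ns))"

text \<open>Composing \<open>k\<close> edges concatenates their lists \<open>ns\<close>, and their
  units add up to \<open>k\<close>. The claim on \<open>D\<close> needs \<open>k > 0\<close>, since
  the zeroth power is the identity even outside \<open>D\<close>.\<close>

lemma tree_rel_pow:
  assumes "(tree_rel X D ^^ k) x y"
  shows "(k > 0 \<longrightarrow> D y) \<and> (\<exists>z ns. y = x @ z \<and> set ns \<subseteq> X \<and>
     length z = k + sum_list (map (\<lambda>n. n - 1) ns))"
  using assms
proof (induction k arbitrary: y)
  case 0
  then show ?case by (auto intro: exI[of _ "[]"])
next
  case (Suc k)
  then obtain u where "(tree_rel X D ^^ k) x u" and uy: "tree_rel X D u y"
    by auto
  from Suc.IH[OF this(1)] obtain z ns where "u = x @ z" "set ns \<subseteq> X"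
    "length z = k + sum_list (map (\<lambda>n. n - 1) ns)"
    by blast
  moreover from uy obtain z' ns' where "y = u @ z'" "set ns' \<subseteq> X" "D y"
    "length z' = 1 + sum_list (map (\<lambda>n. n - 1) ns')"
    by (auto simp: tree_rel_def)
  ultimately show ?case
    by (intro conjI exI[of _ "z @ z'"] exI[of _ "ns @ ns'"]) auto
qed

lemma tree_rel_four:
  assumes "n \<in> X" and "n > 1"
  shows "tree_rel X D ^^ n \<le> tree_rel X D"
proof (intro le_funI le_boolI)
  fix x y assume "(tree_rel X D ^^ n) x y"
  from tree_rel_pow[OF this] assms(2) obtain z ns where "D y" "y = x @ z" "set ns \<subseteq> X"
    "length z = n + sum_list (map (\<lambda>n. n - 1) ns)"
    by auto
  \<comment> \<open>Since \<open>n = 1 + (n - 1)\<close>, the surplus of \<open>n\<close> units over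
    one is booked as a further entry \<open>n\<close> of the list.\<close>
  with assms show "tree_rel X D x y"
    unfolding tree_rel_def by (intro conjI exI[of _ z] exI[of _ "n # ns"]) auto
qed

text \<open>Each entry \<open>n\<close> of the list is one propagation moving \<open>Dia A\<close>
  down by \<open>n - 1\<close>; the remaining unit is the ordinary diamond step that releases
  \<open>A\<close>.\<close>

lemma saturated_Dia:
  assumes sat: "saturated X D H" and X: "\<And>n. n \<in> X \<Longrightarrow> n > 1"
    and "H x (Dia A)" and "tree_rel X D x y"
  shows "H y A"
proof -
  have "H (x @ z) A" if "H x (Dia A)" "D (x @ z)" "set ns \<subseteq> X"
    "length z = 1 + sum_list (map (\<lambda>n. n - 1) ns)" for x z ns
    using that
  proof (induction ns arbitrary: x z)
    case Nil
    then obtain i where "z = [i]"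
      by (auto simp: length_Suc_conv)
    with Nil saturated.Dia[OF sat] show ?case
      by simp
  next
    case (Cons n ns)
    let ?u = "take (n - 1) z" and ?v = "drop (n - 1) z"
    have n: "n \<in> X" "n > 1"
      using Cons.prems(3) X by auto
    have len: "?u \<noteq> []" "length ?u + 1 = n"
      using Cons.prems(4) n(2) by auto
    have D: "D ((x @ ?u) @ ?v)"
      using Cons.prems(2) by simp
    have "H (x @ ?u) (Dia A)"
      by (rule saturated.Dia4[OF sat Cons.prems(1) saturated.prefix[OF sat D] len(1)])
        (simp only: len(2) n(1))
    then have "H ((x @ ?u) @ ?v) A"
      using D by (rule Cons.IH) (use Cons.prems(3,4) in auto)
    then show ?case by simp
  qed
  with assms(3,4) show ?thesis
    unfolding tree_rel_def by blast
qed

text \<open>The valuation makes \<open>p\<close> true exactly where \<open>NegAtom p\<close> must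
  fail; \<open>clash\<close> then falsifies the positive literals.\<close>

lemma saturated_falsifies:
  assumes sat: "saturated X D H" and X: "\<And>n. n \<in> X \<Longrightarrow> n > 1" and "H x A"
  shows "\<not> sat (tree_rel X D) (\<lambda>y p. H y (NegAtom p)) x A"
  using assms(3)
proof (induction A arbitrary: x)
  case (Atom p)
  then show ?case
    using saturated.clash[OF sat] by simp
next
  case (And A B)
  then show ?case
    using saturated.And[OF sat And.prems] by auto
next
  case (Or A B)
  then show ?case
    using saturated.Or[OF sat Or.prems] by auto
next
  case (Box A)
  obtain i where i: "H (x @ [i]) A"
    using saturated.Box[OF sat Box.prems] ..
  then have "tree_rel X D x (x @ [i])"
    using saturated.dom[OF sat i] unfolding tree_rel_def
    by (intro conjI exI[of _ "[i]"] exI[of _ "[]"]) auto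
  with Box.IH[OF i] show ?case by auto
next
  case (Dia A)
  then show ?case
    using saturated_Dia[OF sat X Dia.prems] by auto
qed simp

lemma nK_plus_complete:
  fixes A :: "'a::countable fml"
  assumes X: "\<And>n. n \<in> X \<Longrightarrow> n > 1"
    and valid: "\<And>(R :: nat list \<Rightarrow> nat list \<Rightarrow> bool) V w.
           (\<And>n. n \<in> X \<Longrightarrow> R ^^ n \<le> R) \<Longrightarrow> sat R V w A"
  shows "nK_plus (dia4_rules X) {#Fm A#}"
proof (rule ccontr)
  assume "\<not> ?thesis"
  then have "unprovable X (Node {#A#} [])"
    by (simp add: unprovable_def)
  then obtain D H where DH: "saturated X D H" "\<And>x B. form_at (Node {#A#} []) x B \<Longrightarrow> H x B"
    by (rule unprovable_saturated) blast
  have "H [] A"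
    by (rule DH(2)) (simp add: form_at_def)
  with DH(1) X have "\<not> sat (tree_rel X D) (\<lambda>y p. H y (NegAtom p)) [] A"
    by (rule saturated_falsifies)
  moreover have "sat (tree_rel X D) (\<lambda>y p. H y (NegAtom p)) [] A"
    using X by (intro valid tree_rel_four) auto
  ultimately show False by blast
qed

theorem theorem23:
  fixes X :: "nat set" and A :: "'a::countable fml"
  assumes "X \<subseteq> {n. n > 1}"
  shows "K_plus (four_axioms X) A \<longleftrightarrow> nK_plus (dia4_rules X) {#Fm A#}"
proof
  assume "K_plus (four_axioms X) A"
  \<comment> \<open>Soundness holds over any type of points, here over the addresses on which the
    countermodel is built.\<close>
  then show "nK_plus (dia4_rules X) {#Fm A#}"
    using assms by (intro nK_plus_complete K_plus_sound) auto
next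
  assume "nK_plus (dia4_rules X) {#Fm A#}"
  \<comment> \<open>Here soundness is taken over sets of formulas, the points of the canonical
    model.\<close>
  then have "sat R V w A" if "\<And>n. n \<in> X \<Longrightarrow> R ^^ n \<le> R"
    for R :: "'a fml set \<Rightarrow> 'a fml set \<Rightarrow> bool" and V w
    using nK_plus_sound[of X "{#Fm A#}" R V w] that by simp
  then show "K_plus (four_axioms X) A"
    using assms by (intro K_plus_complete) auto
qed

end
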